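(* Let $g(z)=\frac{az+b}{cz+d}$ be a hyperbolic Möbius map with $a,b,c,d\in\mathbb{C}$, $ad-bc=1$, $c\ne0$ and trace $a+d=2+\tau$ for some real $\tau>0$. Let $0<t\le\tau$ and let $$S(1+t)=\left\{z\in\mathbb{C}:\left|z+\frac dc\right|>\frac{1+t}{|c|}\right\}.$$ There is a function $G:\left(0,\frac{t}{|c|(1+t)}\right)\to(0,\infty)$ with $\lim_{\varepsilon\to0}G(\varepsilon)=0$ such that the following holds. Let $0<\varepsilon<\frac{t}{|c|(1+t)}$ and let $\{a_i\}_{i\in\mathbb{N}_0}$ be a complex valued sequence with $a_0\in S(1+t)$ and $|a_{i+1}-g(a_i)|\le\varepsilon$ for all $i\in\mathbb{N}_0$. Then $a_i\in S(1+t)$ for all $i\in\mathbb{N}_0$. Moreover, there exists a complex valued sequence $\{b_i\}_{i\in\mathbb{N}_0}$ with $b_0=a_0$, $b_{i+1}=g(b_i)$ for all $i\in\mathbb{N}_0$, and $|a_i-b_i|\le G(\varepsilon)$ for all $i\in\mathbb{N}_0$ (that is, $\{b_i\}$ has Hyers-Ulam stability).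
   Context: $\mathbb{N}_0=\{0,1,2,\dots\}$. A Möbius map $g(z)=\frac{az+b}{cz+d}$ with $ad-bc=1$ is hyperbolic if $a+d\in\mathbb{R}\setminus[-2,2]$. Hyers-Ulam stability of the sequence $\{b_i\}$ with $b_{i+1}=F(i,b_i)$, relative to a sequence $\{a_i\}$ with $|a_{i+1}-F(i,a_i)|\le\varepsilon$, means $|a_i-b_i|\le G(\varepsilon)$ for all $i\in\mathbb{N}_0$, where the positive number $G(\varepsilon)$ converges to $0$ as $\varepsilon\to0$; here $F(i,z)=g(z)$. The inequality $|a_{i+1}-g(a_i)|\le\varepsilon$ includes the requirement that $g(a_i)\ne\infty$. *)

theory Defs
  imports Complex_Main
begin

text \<open>
  The Moebius map z |-> (a z + b) / (c z + d) restricted to the finite complex plane.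
  The value \<^term>\<open>None\<close> stands for the point at infinity of the Riemann sphere, so that the
  convention x / 0 = 0 is never used at the pole.
\<close>
definition moebius :: "complex \<Rightarrow> complex \<Rightarrow> complex \<Rightarrow> complex \<Rightarrow> complex \<Rightarrow> complex option" where
  "moebius a b c d z = (if c * z + d = 0 then None else Some ((a * z + b) / (c * z + d)))"

definition hyperbolic :: "complex \<Rightarrow> complex \<Rightarrow> complex \<Rightarrow> complex \<Rightarrow> bool" where
  "hyperbolic a b c d \<longleftrightarrow>
     a * d - b * c = 1 \<and> a + d \<in> complex_of_real ` (UNIV - {-2..2})"

definition S_region :: "complex \<Rightarrow> complex \<Rightarrow> real \<Rightarrow> complex set" where
  "S_region c d r = {z. norm (z + d / c) > r / norm c}"

text \<open>
  In both notions below the sequence is complex valued, and every value of F along it is required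
  to be finite.
\<close>
definition orbit :: "(nat \<Rightarrow> complex \<Rightarrow> complex option) \<Rightarrow> (nat \<Rightarrow> complex) \<Rightarrow> bool" where
  "orbit F v \<longleftrightarrow> (\<forall>i. F i (v i) = Some (v (Suc i)))"

definition approx_orbit ::
  "(nat \<Rightarrow> complex \<Rightarrow> complex option) \<Rightarrow> real \<Rightarrow> (nat \<Rightarrow> complex) \<Rightarrow> bool" where
  "approx_orbit F \<epsilon> u \<longleftrightarrow> (\<forall>i. \<exists>w. F i (u i) = Some w \<and> norm (u (Suc i) - w) \<le> \<epsilon>)"

end

theory Submission imports Defs begin

text \<open>
  In the coordinate \<open>w = c z + d\<close> the map \<open>g\<close> becomes \<open>w \<mapsto> (a + d) - 1/w\<close>, because
  \<open>a d - b c = 1\<close>, and the region \<open>S(r)\<close> becomes the exterior \<open>\<bar>w\<bar> > r\<close> of a disc centred at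
  the pole.  Both halves of the result are visible there.

  Invariance: if \<open>\<bar>w\<bar> > 1 + t\<close> then \<open>\<bar>2 + \<tau> - 1/w\<bar> > 2 + \<tau> - 1/(1 + t)\<close>, which exceeds
  \<open>1 + t\<close> by at least \<open>t/(1 + t)\<close>.  An error of \<open>\<epsilon>\<close> in \<open>z\<close> is an error of \<open>\<bar>c\<bar> \<epsilon>\<close> in \<open>w\<close>, so
  the bound \<open>\<bar>c\<bar> \<epsilon> < t/(1 + t)\<close> keeps a perturbed orbit in the region.

  Stability: \<open>1/w - 1/w' = (w' - w)/(w w')\<close>, so \<open>g\<close> contracts distances on the region by
  the factor \<open>K = 1/(1 + t)\<^sup>2 < 1\<close>.  The distance between the perturbed orbit and the true one
  with the same starting point therefore obeys \<open>\<delta>(i+1) \<le> K \<delta>(i) + \<epsilon>\<close>, and it never exceeds the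
  fixed point of this recursion, which gives \<open>G(\<epsilon>) = \<epsilon>/(1 - K)\<close>.
\<close>

lemma S_region_iff_norm_denominator:
  assumes "c \<noteq> 0"
  shows "z \<in> S_region c d r \<longleftrightarrow> r < norm (c * z + d)"
proof -
  have "c * z + d = c * (z + d / c)"
    using assms by (simp add: field_simps)
  then have "norm (c * z + d) = norm c * norm (z + d / c)"
    by (simp only: norm_mult)
  then show ?thesis
    using assms by (simp add: S_region_def field_simps)
qed

lemma moebius_denominator:
  assumes "a * d - b * c = 1" and "moebius a b c d z = Some w"
  shows "c * w + d = (a + d) - 1 / (c * z + d)"
proof -
  have nz: "c * z + d \<noteq> 0" and w: "w = (a * z + b) / (c * z + d)"
    using assms(2) by (auto simp: moebius_def split: if_splits)
  have "c * (a * z + b) + d * (c * z + d) = (a + d) * (c * z + d) - (a * d - b * c)"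
    by (simp add: algebra_simps)
  then show ?thesis
    using nz by (simp add: w assms(1) field_simps)
qed

lemma moebius_finite_on_S_region:
  assumes "c \<noteq> 0" "0 \<le> r" "z \<in> S_region c d r"
  obtains w where "moebius a b c d z = Some w"
proof -
  have "c * z + d \<noteq> 0"
    using assms S_region_iff_norm_denominator[of c z d r] by auto
  then show thesis
    using that by (simp add: moebius_def)
qed

text \<open>
  The term \<open>1/(c z + d)\<close> is at most \<open>1/(1 + t)\<close> and the error, magnified by \<open>c\<close>, is below
  \<open>t/(1 + t)\<close>.  These two add up to less than \<open>1\<close>, so \<open>\<bar>c x + d\<bar>\<close> stays above
  \<open>(2 + \<tau>) - 1 = 1 + \<tau> \<ge> 1 + t\<close>.
\<close>
lemma S_region_invariant_step:
  assumes "a * d - b * c = 1" "c \<noteq> 0" "a + d = complex_of_real (2 + \<tau>)" "0 < t" "t \<le> \<tau>"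
    and \<epsilon>: "\<epsilon> < t / (norm c * (1 + t))"
    and z: "z \<in> S_region c d (1 + t)"
    and w: "moebius a b c d z = Some w"
    and x: "norm (x - w) \<le> \<epsilon>"
  shows "x \<in> S_region c d (1 + t)"
proof -
  have z': "1 + t < norm (c * z + d)"
    using z assms(2) by (simp add: S_region_iff_norm_denominator)
  have inv: "norm (1 / (c * z + d)) \<le> 1 / (1 + t)"
    using z' assms(4) by (simp add: norm_divide frac_le)
  have "norm c * norm (x - w) \<le> norm c * \<epsilon>"
    using x by (simp add: mult_left_mono)
  also have "\<dots> < t / (1 + t)"
    using mult_strict_left_mono[OF \<epsilon>, of "norm c"] assms(2) by simp
  finally have err: "norm (c * (x - w)) < t / (1 + t)"
    by (simp add: norm_mult)
  have dec: "complex_of_real (2 + \<tau>) = (c * x + d) + (1 / (c * z + d) - c * (x - w))"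
    using moebius_denominator[OF assms(1) w] assms(3) by (simp add: algebra_simps)
  have "2 + \<tau> = norm (complex_of_real (2 + \<tau>))"
    using assms(4,5) by (simp only: norm_of_real)
  also have "\<dots> \<le> norm (c * x + d) + (norm (1 / (c * z + d)) + norm (c * (x - w)))"
    unfolding dec by (meson norm_triangle_ineq norm_triangle_ineq4 add_left_mono order_trans)
  also have "\<dots> < norm (c * x + d) + (1 / (1 + t) + t / (1 + t))"
    using inv err by simp
  also have "1 / (1 + t) + t / (1 + t) = 1"
    using assms(4) by (simp add: field_simps)
  finally show ?thesis
    using assms(2,5) by (simp add: S_region_iff_norm_denominator)
qed

lemma approx_orbit_in_S_region:
  assumes "a * d - b * c = 1" "c \<noteq> 0" "a + d = complex_of_real (2 + \<tau>)" "0 < t" "t \<le> \<tau>"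
    and "\<epsilon> < t / (norm c * (1 + t))"
    and "u 0 \<in> S_region c d (1 + t)"
    and orb: "approx_orbit (\<lambda>i. moebius a b c d) \<epsilon> u"
  shows "u i \<in> S_region c d (1 + t)"
proof (induction i)
  case (Suc i)
  from orb obtain w where "moebius a b c d (u i) = Some w" "norm (u (Suc i) - w) \<le> \<epsilon>"
    unfolding approx_orbit_def by blast
  with Suc show ?case
    using S_region_invariant_step[OF assms(1-6)] by blast
qed (fact assms(7))

lemma moebius_contraction:
  assumes "a * d - b * c = 1" "c \<noteq> 0" "0 < r"
    and "x \<in> S_region c d r" "y \<in> S_region c d r"
    and x': "moebius a b c d x = Some x'" and y': "moebius a b c d y = Some y'"
  shows "norm (x' - y') \<le> norm (x - y) / r\<^sup>2"
proof -
  have x: "r < norm (c * x + d)" and y: "r < norm (c * y + d)"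
    using assms(2,4,5) by (simp_all add: S_region_iff_norm_denominator)
  then have nz: "c * x + d \<noteq> 0" "c * y + d \<noteq> 0"
    using assms(3) by auto
  have "c * (x' - y') = (c * x' + d) - (c * y' + d)"
    by (simp add: algebra_simps)
  also have "\<dots> = 1 / (c * y + d) - 1 / (c * x + d)"
    by (simp add: moebius_denominator[OF assms(1) x'] moebius_denominator[OF assms(1) y'])
  also have "\<dots> = c * ((x - y) / ((c * x + d) * (c * y + d)))"
    using nz by (simp add: diff_frac_eq algebra_simps)
  finally have "x' - y' = (x - y) / ((c * x + d) * (c * y + d))"
    using assms(2) mult_left_cancel by blast
  then have "norm (x' - y') = norm (x - y) / (norm (c * x + d) * norm (c * y + d))"
    by (simp add: norm_mult norm_divide)
  also have "\<dots> \<le> norm (x - y) / r\<^sup>2"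
    unfolding power2_eq_square
    using x y assms(3) by (intro divide_left_mono mult_mono mult_pos_pos) auto
  finally show ?thesis .
qed

lemma perturbed_contraction_bound:
  fixes \<delta> :: "nat \<Rightarrow> real"
  assumes "0 \<le> K" "K < 1" "0 \<le> \<epsilon>" "\<delta> 0 = 0"
    and step: "\<And>i. \<delta> (Suc i) \<le> K * \<delta> i + \<epsilon>"
  shows "\<delta> i \<le> \<epsilon> / (1 - K)"
proof (induction i)
  case 0
  then show ?case using assms by simp
next
  case (Suc i)
  have "\<delta> (Suc i) \<le> K * (\<epsilon> / (1 - K)) + \<epsilon>"
    using step[of i] mult_left_mono[OF Suc assms(1)] by linarith
  also have "\<dots> = \<epsilon> / (1 - K)"
    using assms(2) by (simp add: field_simps)
  finally show ?case .
qed

lemma orbit_imp_approx_orbit: "orbit F v \<Longrightarrow> 0 \<le> \<epsilon> \<Longrightarrow> approx_orbit F \<epsilon> v"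
  by (auto simp: orbit_def approx_orbit_def)

text \<open>
  A true orbit never meets the pole because each point of it lies in the region, so that
  invariance enters already in the construction, before any estimate.
\<close>
lemma orbit_exists_from_S_region:
  assumes "a * d - b * c = 1" "c \<noteq> 0" "a + d = complex_of_real (2 + \<tau>)" "0 < t" "t \<le> \<tau>"
    and z: "z \<in> S_region c d (1 + t)"
  obtains v where "v 0 = z" "orbit (\<lambda>i. moebius a b c d) v"
proof -
  have "\<exists>w. moebius a b c d x = Some w \<and> w \<in> S_region c d (1 + t)"
    if x: "x \<in> S_region c d (1 + t)" for x
  proof -
    obtain w where w: "moebius a b c d x = Some w"
      using moebius_finite_on_S_region[OF assms(2) _ x] assms(4) by auto
    have "0 < t / (norm c * (1 + t))"
      using assms(2,4) by simp
    from S_region_invariant_step[OF assms(1-5) this x w, of w] w show ?thesis by simp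
  qed
  then have "\<exists>v. v 0 = z \<and> (\<forall>i. v i \<in> S_region c d (1 + t)
      \<and> moebius a b c d (v i) = Some (v (Suc i)))"
    using dependent_nat_choice[where P = "\<lambda>i x. x \<in> S_region c d (1 + t) \<and> (i = 0 \<longrightarrow> x = z)"
        and Q = "\<lambda>_ x y. moebius a b c d x = Some y"] z
    by (metis nat.distinct(1))
  then show thesis
    using that unfolding orbit_def by blast
qed

theorem proposition3p3:
  fixes a b c d :: complex and \<tau> t :: real
  assumes "hyperbolic a b c d"
    and "c \<noteq> 0"
    and "\<tau> > 0"
    and "a + d = complex_of_real (2 + \<tau>)"
    and "0 < t" and "t \<le> \<tau>"
  shows "\<exists>G :: real \<Rightarrow> real.
    (\<forall>\<epsilon> \<in> {0<..<t / (norm c * (1 + t))}. G \<epsilon> > 0) \<and>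
    (G \<longlongrightarrow> 0) (at 0 within {0<..<t / (norm c * (1 + t))}) \<and>
    (\<forall>\<epsilon> \<in> {0<..<t / (norm c * (1 + t))}. \<forall>u :: nat \<Rightarrow> complex.
       u 0 \<in> S_region c d (1 + t) \<and> approx_orbit (\<lambda>i. moebius a b c d) \<epsilon> u \<longrightarrow>
         (\<forall>i. u i \<in> S_region c d (1 + t)) \<and>
         (\<exists>v :: nat \<Rightarrow> complex. v 0 = u 0 \<and> orbit (\<lambda>i. moebius a b c d) v \<and>
            (\<forall>i. norm (u i - v i) \<le> G \<epsilon>)))"
proof -
  define E where "E = t / (norm c * (1 + t))"
  define K where "K = 1 / (1 + t)\<^sup>2"
  have det: "a * d - b * c = 1"
    using assms(1) by (simp add: hyperbolic_def)
  note hyp = det assms(2,4-6)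
  have "1 < (1 + t)\<^sup>2"
    using assms(5) by (simp add: one_less_power)
  then have K: "0 \<le> K" "K < 1"
    by (simp_all add: K_def divide_less_eq)
  show ?thesis
    unfolding E_def[symmetric]
  proof (intro exI[of _ "\<lambda>\<epsilon>. \<epsilon> / (1 - K)"] conjI ballI allI impI)
    fix \<epsilon> assume "\<epsilon> \<in> {0<..<E}"
    then show "0 < \<epsilon> / (1 - K)" using K by simp
  next
    show "((\<lambda>\<epsilon>. \<epsilon> / (1 - K)) \<longlongrightarrow> 0) (at 0 within {0<..<E})"
      using K by (auto intro!: tendsto_eq_intros)
  next
    fix \<epsilon> :: real and u :: "nat \<Rightarrow> complex" and i
    assume "\<epsilon> \<in> {0<..<E}" "u 0 \<in> S_region c d (1 + t) \<and> approx_orbit (\<lambda>i. moebius a b c d) \<epsilon> u"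
    then show "u i \<in> S_region c d (1 + t)"
      using approx_orbit_in_S_region[OF hyp] by (auto simp: E_def)
  next
    fix \<epsilon> :: real and u :: "nat \<Rightarrow> complex"
    assume \<epsilon>: "\<epsilon> \<in> {0<..<E}"
      and u: "u 0 \<in> S_region c d (1 + t) \<and> approx_orbit (\<lambda>i. moebius a b c d) \<epsilon> u"
    obtain v where v0: "v 0 = u 0" and v: "orbit (\<lambda>i. moebius a b c d) v"
      using orbit_exists_from_S_region[OF hyp] u by blast
    have uS: "u i \<in> S_region c d (1 + t)" for i
      using approx_orbit_in_S_region[OF hyp] \<epsilon> u by (auto simp: E_def)
    have vS: "v i \<in> S_region c d (1 + t)" for i
      using approx_orbit_in_S_region[OF hyp, of \<epsilon> v] orbit_imp_approx_orbit[OF v, of \<epsilon>] \<epsilon> u v0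
      by (auto simp: E_def)
    have step: "norm (u (Suc i) - v (Suc i)) \<le> K * norm (u i - v i) + \<epsilon>" for i
    proof -
      obtain w where w: "moebius a b c d (u i) = Some w" and err: "norm (u (Suc i) - w) \<le> \<epsilon>"
        using u unfolding approx_orbit_def by blast
      have "moebius a b c d (v i) = Some (v (Suc i))"
        using v by (simp add: orbit_def)
      then have "norm (w - v (Suc i)) \<le> K * norm (u i - v i)"
        using moebius_contraction[OF det assms(2) _ uS vS w] assms(5) by (simp add: K_def)
      then show ?thesis
        using err norm_triangle_ineq[of "u (Suc i) - w" "w - v (Suc i)"] by simp
    qed
    have "norm (u i - v i) \<le> \<epsilon> / (1 - K)" for i
      using perturbed_contraction_bound[OF K, of \<epsilon> "\<lambda>i. norm (u i - v i)"] step v0 \<epsilon> by simp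
    then show "\<exists>v. v 0 = u 0 \<and> orbit (\<lambda>i. moebius a b c d) v
        \<and> (\<forall>i. norm (u i - v i) \<le> \<epsilon> / (1 - K))"
      using v0 v by blast
  qed
qed

end
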